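(* Let $N$ be a project and let $k\ge 1$ be an integer with $k\le k_{\max}(N)$. Suppose the greedy algorithm, run on $N$ and $k$, produces the plan $G=A_1\uplus\cdots\uplus A_k$ (at iteration $i$, $A_i$ is a minimum-cost $1$-crashing plan of the accelerated project $N(A_1\uplus\cdots\uplus A_{i-1})$). Let $\mathsf{OPT}$ be a minimum-cost $k$-crashing plan of $N$. Then $$\mathrm{cost}(G)\le \Big(\sum_{i=1}^{k}\frac{1}{i}\Big)\,\mathrm{cost}(\mathsf{OPT}).$$
   Context: A project is a finite directed acyclic graph $N=(V,E)$ with a unique source $s$ (no incoming edges) and a unique sink $t$ (no outgoing edges). Each edge (job) $e_i\in E$ has three attributes $(a_i,b_i,c_i)$: integers $0\le a_i\le b_i$ and a cost rate $c_i\ge 0$. The length of $e_i$ is $b_i$. A path of $N$ means a directed path from $s$ to $t$, and its length is the sum of the lengths of its edges. The duration $d(N)$ is the maximum length of a path. An (accelerate) plan $X$ is a multiset of edges of $N$ in which $e_i$ has multiplicity $x_i$ with $0\le x_i\le b_i-a_i$; its cost is $\mathrm{cost}(X)=\sum_i c_i x_i$. The accelerated project $N(X)$ is the project obtained from $N$ by replacing each $b_i$ by $b_i-x_i$ (so a plan for $N(X)$ may use $e_i$ with multiplicity at most $b_i-x_i-a_i$). A plan $X$ is $k$-crashing for $N$ if the duration is shortened by $k$, i.e. $d(N(X))=d(N)-k$. Let $E_{b\setminus a}$ denote the plan in which each $e_i$ has multiplicity $b_i-a_i$, and $k_{\max}(N)=d(N)-d(N(E_{b\setminus a}))$. Greedy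 algorithm: set $G=\varnothing$; for $i=1,\dots,k$, let $A_i$ be a minimum-cost $1$-crashing plan of $N(G)$ and set $G\leftarrow G\uplus A_i$ (multiset union). *)

theory Defs
  imports Complex_Main "HOL-Library.Multiset" "Graph_Theory.Graph_Theory"
begin

text \<open>The attributes of a job \<open>e\<close> are \<open>(a, b, c) = (min_len N e, len N e, rate N e)\<close>.\<close>

record ('v, 'e) job_network =
  network :: "('v, 'e) pre_digraph"
  source :: 'v
  sink :: 'v
  min_len :: "'e \<Rightarrow> nat"
  len :: "'e \<Rightarrow> nat"
  rate :: "'e \<Rightarrow> real"

text \<open>Parallel edges are allowed; self-loops are excluded by acyclicity.\<close>

locale project = fin_digraph "network N" for N :: "('v, 'e) job_network" +
  assumes acyclic: "acyclic (arcs_ends (network N))"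
    and source_in_verts: "source N \<in> verts (network N)"
    and sink_in_verts: "sink N \<in> verts (network N)"
    and unique_source: "v \<in> verts (network N) \<Longrightarrow> in_arcs (network N) v = {} \<longleftrightarrow> v = source N"
    and unique_sink: "v \<in> verts (network N) \<Longrightarrow> out_arcs (network N) v = {} \<longleftrightarrow> v = sink N"
    and min_len_le_len: "e \<in> arcs (network N) \<Longrightarrow> min_len N e \<le> len N e"
    and rate_nonneg: "e \<in> arcs (network N) \<Longrightarrow> 0 \<le> rate N e"

definition project_paths :: "('v, 'e) job_network \<Rightarrow> 'e awalk set" where
  "project_paths N = {p. pre_digraph.apath (network N) (source N) p (sink N)}"

definition path_len :: "('v, 'e) job_network \<Rightarrow> 'e awalk \<Rightarrow> nat" where
  "path_len N p = (\<Sum>e\<leftarrow>p. len N e)"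

definition duration :: "('v, 'e) job_network \<Rightarrow> nat" where
  "duration N = Max (path_len N ` project_paths N)"

definition is_plan :: "('v, 'e) job_network \<Rightarrow> 'e multiset \<Rightarrow> bool" where
  "is_plan N X \<longleftrightarrow> set_mset X \<subseteq> arcs (network N) \<and>
     (\<forall>e \<in> arcs (network N). count X e \<le> len N e - min_len N e)"

definition cost :: "('v, 'e) job_network \<Rightarrow> 'e multiset \<Rightarrow> real" where
  "cost N X = (\<Sum>e \<in> arcs (network N). rate N e * real (count X e))"

text \<open>The accelerated project \<open>N(X)\<close>. For a plan \<open>X\<close> of a project the subtraction on
  natural numbers is never truncated on an edge.\<close>

definition accelerate :: "('v, 'e) job_network \<Rightarrow> 'e multiset \<Rightarrow> ('v, 'e) job_network" where
  "accelerate N X = N\<lparr>len := \<lambda>e. len N e - count X e\<rparr>"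

text \<open>The difference of durations is taken in the integers: on natural numbers
  \<open>duration N - k\<close> would be \<open>0\<close> for every \<open>k\<close> larger than \<open>duration N\<close>.\<close>

definition crashing :: "nat \<Rightarrow> ('v, 'e) job_network \<Rightarrow> 'e multiset \<Rightarrow> bool" where
  "crashing k N X \<longleftrightarrow> is_plan N X \<and>
     int (duration (accelerate N X)) = int (duration N) - int k"

definition min_cost_crashing :: "nat \<Rightarrow> ('v, 'e) job_network \<Rightarrow> 'e multiset \<Rightarrow> bool" where
  "min_cost_crashing k N X \<longleftrightarrow> is_arg_min (cost N) (crashing k N) X"

text \<open>The plan \<open>E\<^bsub>b\a\<^esub>\<close>.\<close>

definition full_plan :: "('v, 'e) job_network \<Rightarrow> 'e multiset" where
  "full_plan N = (\<Sum>e \<in> arcs (network N). replicate_mset (len N e - min_len N e) e)"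

definition k_max :: "('v, 'e) job_network \<Rightarrow> int" where
  "k_max N = int (duration N) - int (duration (accelerate N (full_plan N)))"

text \<open>\<open>A 1, \<dots>, A k\<close> are the plans chosen by one run of the greedy algorithm. The choice of
  each \<open>A i\<close> among the minimum-cost plans is arbitrary, and \<open>\<Sum>\<close> is multiset union here.\<close>

definition greedy_run :: "('v, 'e) job_network \<Rightarrow> nat \<Rightarrow> (nat \<Rightarrow> 'e multiset) \<Rightarrow> bool" where
  "greedy_run N k A \<longleftrightarrow>
     (\<forall>i \<in> {1..k}. min_cost_crashing 1 (accelerate N (\<Sum>j \<in> {1..<i}. A j)) (A i))"

end

theory Submission
  imports Defs
begin

text \<open>
  Let \<open>X\<close> be a plan that shortens a project by at least \<open>m \<ge> 1\<close>. For a vertex \<open>v\<close> let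
  \<open>\<delta> v\<close> be the amount by which \<open>X\<close> shortens the longest walk from the source to \<open>v\<close>.
  For \<open>1 \<le> j \<le> m\<close> the edges of critical paths along which \<open>\<delta>\<close> passes from below \<open>j\<close> to at
  least \<open>j\<close> meet every critical path, and along an edge \<open>e\<close> on a critical path \<open>\<delta>\<close>
  grows by at most the multiplicity of \<open>e\<close> in \<open>X\<close>. Averaging over \<open>j\<close> gives a \<open>1\<close>-crashing plan of
  cost at most \<open>cost X / m\<close>. At step \<open>i\<close> of the greedy algorithm this applies to
  \<open>X = OPT - (A 1 + \<dots> + A (i - 1))\<close> with \<open>m = k - i + 1\<close>.
\<close>

section \<open>Longest walks in acyclic digraphs\<close>

text \<open>Ranging over \<open>apath\<close> keeps the set finite and matches
  \<open>project_paths\<close>. For unconnected \<open>u\<close> and \<open>v\<close> the value is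
  an unspecified \<open>Max {}\<close>, so the lemmas below take some walk as a witness.\<close>

definition (in pre_digraph) max_len :: "('b \<Rightarrow> nat) \<Rightarrow> 'a \<Rightarrow> 'a \<Rightarrow> nat" where
  "max_len f u v = Max ((\<lambda>p. sum_list (map f p)) ` {p. apath u p v})"

locale fin_dag = fin_digraph +
  assumes acyclic_arcs: "acyclic (arcs_ends G)"
begin

text \<open>A repeated vertex would split off a nonempty closed walk. Hence walks may be
  concatenated freely and still compete in \<open>max_len\<close>.\<close>

lemma awalk_imp_apath:
  assumes "awalk u p v"
  shows "apath u p v"
proof (rule ccontr)
  assume "\<not> apath u p v"
  then have "\<not> distinct (awalk_verts u p)"
    using assms by (auto simp: apath_def)
  then obtain q r s w where "awalk w r w" "r \<noteq> []"
    using awalk_not_distinct_decomp[OF assms] by (auto simp: closed_w_def)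
  then show False
    using acyclic_arcs reachable1_awalkI by (auto simp: acyclic_def)
qed

lemma awalk_distinct: "awalk u p v \<Longrightarrow> distinct p"
  using awalk_imp_apath distinct_verts_imp_distinct by (auto simp: apath_def)

lemma max_len_ge:
  assumes "awalk u p v"
  shows "sum_list (map f p) \<le> max_len f u v"
  unfolding max_len_def using awalk_imp_apath[OF assms] apaths_finite
  by (intro Max_ge) auto

lemma max_len_attained:
  assumes "awalk u q v"
  obtains p where "awalk u p v" "sum_list (map f p) = max_len f u v"
proof -
  have "max_len f u v \<in> (\<lambda>p. sum_list (map f p)) ` {p. apath u p v}"
    unfolding max_len_def using awalk_imp_apath[OF assms] apaths_finite by (intro Max_in) auto
  then show ?thesis
    using that by (auto simp: apath_def)
qed

lemma max_len_mono:
  assumes "awalk u q v" and "\<And>e. f e \<le> g e"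
  shows "max_len f u v \<le> max_len g u v"
proof -
  obtain p where "awalk u p v" "sum_list (map f p) = max_len f u v"
    using max_len_attained[OF assms(1)] .
  then show ?thesis
    using max_len_ge[of u p v g] sum_list_mono[of p f g] assms(2) by simp
qed

lemma max_len_extend:
  assumes "awalk u q v" "awalk v p w"
  shows "max_len f u v + sum_list (map f p) \<le> max_len f u w"
proof -
  obtain r where "awalk u r v" "sum_list (map f r) = max_len f u v"
    using max_len_attained[OF assms(1)] .
  then show ?thesis
    using max_len_ge[of u "r @ p" w f] assms(2) by auto
qed

text \<open>A walk in an acyclic digraph uses the arc \<open>a\<close> at most once, so its length
  changes by at most the change at \<open>a\<close>.\<close>

lemma max_len_decrease_unit:
  assumes "awalk u q v" "\<And>e. e \<noteq> a \<Longrightarrow> f e = g e" "f a \<le> g a + 1"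
  shows "max_len f u v \<le> max_len g u v + 1"
proof -
  obtain p where p: "awalk u p v" "sum_list (map f p) = max_len f u v"
    using max_len_attained[OF assms(1)] .
  have "sum_list (map f p) \<le> sum_list (map g p) + 1"
    using awalk_distinct[OF p(1)]
  proof (induction p)
    case (Cons b p)
    show ?case
    proof (cases "b = a")
      case True
      then have "sum_list (map f p) = sum_list (map g p)"
        using Cons.prems by (intro arg_cong[where f = sum_list] map_cong refl assms(2)) auto
      then show ?thesis using True assms(3) by simp
    next
      case False
      then show ?thesis using Cons assms(2) by simp
    qed
  qed simp
  then show ?thesis
    using p max_len_ge[OF p(1), of g] by simp
qed

text \<open>Every arc of a critical walk is tight; the first one whose head reaches level
  \<open>j\<close> is the required arc.\<close>

lemma crossing_arc:
  fixes \<delta> :: "'a \<Rightarrow> int"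
  assumes "awalk s q u" "awalk u p v"
    and "max_len f s v = max_len f s u + sum_list (map f p)"
    and "\<delta> u < j" "j \<le> \<delta> v"
  shows "\<exists>e \<in> set p. e \<in> arcs G \<and> s \<rightarrow>\<^sup>* tail G e \<and>
    max_len f s (head G e) = max_len f s (tail G e) + f e \<and> \<delta> (tail G e) < j \<and> j \<le> \<delta> (head G e)"
  using assms
proof (induction p arbitrary: q u)
  case Nil
  then show ?case by (auto simp: awalk_Nil_iff)
next
  case (Cons e p)
  let ?w = "head G e"
  have e: "e \<in> arcs G" "tail G e = u" and p: "awalk ?w p v"
    using Cons.prems(2) by (auto simp: awalk_Cons_iff)
  have step: "awalk u [e] ?w"
    using e p by (auto simp: awalk_simps)
  have q: "awalk s (q @ [e]) ?w"
    using Cons.prems(1) step by auto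
  have "max_len f s u + f e \<le> max_len f s ?w"
    using max_len_extend[OF Cons.prems(1) step, of f] by simp
  moreover have "max_len f s ?w + sum_list (map f p) \<le> max_len f s v"
    using max_len_extend[OF q p, of f] .
  \<comment> \<open>The two inequalities add up to the assumed equality, so neither can be
    strict.\<close>
  ultimately have tight: "max_len f s ?w = max_len f s u + f e"
    and rest: "max_len f s v = max_len f s ?w + sum_list (map f p)"
    using Cons.prems(3) by auto
  show ?case
  proof (cases "j \<le> \<delta> ?w")
    case True
    then show ?thesis
      using e tight Cons.prems(1,4) reachable_awalk by auto
  next
    case False
    then show ?thesis
      using Cons.IH[OF q p rest _ Cons.prems(5)] by auto
  qed
qed

text \<open>This packs \<open>m\<close> cuts of the critical walks into the capacities
  \<open>x\<close>: an arc lies in one cut for each level in \<open>{1..m}\<close> that \<delta>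
  passes along it.\<close>

lemma level_cuts:
  assumes "awalk s q t" and "max_len (\<lambda>e. f e - x e) s t + m \<le> max_len f s t"
  obtains C :: "nat \<Rightarrow> 'b set"
  where "\<And>j. C j \<subseteq> arcs G"
    and "\<And>j p. \<lbrakk>j \<in> {1..m}; awalk s p t; sum_list (map f p) = max_len f s t\<rbrakk> \<Longrightarrow> set p \<inter> C j \<noteq> {}"
    and "\<And>e. card {j \<in> {1..m}. e \<in> C j} \<le> x e"
proof -
  define g where "g = (\<lambda>e. f e - x e)"
  define \<delta> where "\<delta> v = int (max_len f s v) - int (max_len g s v)" for v
  \<comment> \<open>Reachability of the tail ensures that \<open>max_len\<close> there is the length
    of an actual walk, which \<open>e\<close> can extend.\<close>
  define C where "C j = {e \<in> arcs G. s \<rightarrow>\<^sup>* tail G e \<and>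
    max_len f s (head G e) = max_len f s (tail G e) + f e \<and>
    \<delta> (tail G e) < int j \<and> int j \<le> \<delta> (head G e)}" for j
  have s: "awalk s [] s"
    using assms(1) by (auto simp: awalk_Nil_iff)
  have "max_len h s s = 0" for h
  proof -
    obtain p where "awalk s p s" "sum_list (map h p) = max_len h s s"
      using max_len_attained[OF s] .
    moreover from this have "p = []"
      using acyclic_arcs reachable1_awalkI by (auto simp: acyclic_def)
    ultimately show ?thesis by simp
  qed
  then have \<delta>s: "\<delta> s = 0" and ms: "max_len f s s = 0"
    by (auto simp: \<delta>_def)
  have \<delta>t: "int m \<le> \<delta> t"
    using assms(2) by (simp add: \<delta>_def g_def)
  show ?thesis
  proof
    show "C j \<subseteq> arcs G" for j
      by (auto simp: C_def)
  next
    fix j p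
    assume "j \<in> {1..m}" "awalk s p t" "sum_list (map f p) = max_len f s t"
    then show "set p \<inter> C j \<noteq> {}"
      using crossing_arc[OF s, of p t f \<delta> "int j"] \<delta>s \<delta>t ms by (auto simp: C_def)
  next
    fix e
    show "card {j \<in> {1..m}. e \<in> C j} \<le> x e"
    proof (cases "\<exists>j. e \<in> C j")
      case True
      then have e: "e \<in> arcs G" "s \<rightarrow>\<^sup>* tail G e"
        and tight: "max_len f s (head G e) = max_len f s (tail G e) + f e"
        by (auto simp: C_def)
      obtain r where r: "awalk s r (tail G e)"
        using e(2) reachable_awalk by auto
      have "awalk (tail G e) [e] (head G e)"
        using e(1) by (auto simp: awalk_simps)
      from max_len_extend[OF r this, of g]
      \<comment> \<open>Across \<open>e\<close> the longest \<open>f\<close>-length grows by exactly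
        \<open>f e\<close>, the longest \<open>g\<close>-length by at least
        \<open>f e - x e\<close>; truncating that difference at zero only raises the latter.\<close>
      have grow: "\<delta> (head G e) \<le> \<delta> (tail G e) + int (x e)"
        using tight by (simp add: \<delta>_def g_def)
      have "int ` {j \<in> {1..m}. e \<in> C j} \<subseteq> {\<delta> (tail G e)<..\<delta> (head G e)}"
        by (auto simp: C_def)
      then have "card (int ` {j \<in> {1..m}. e \<in> C j}) \<le> card {\<delta> (tail G e)<..\<delta> (head G e)}"
        by (intro card_mono) auto
      also have "card (int ` {j \<in> {1..m}. e \<in> C j}) = card {j \<in> {1..m}. e \<in> C j}"
        by (intro card_image) auto
      finally show ?thesis
        using grow by simp
    qed simp
  qed
qed

end

section \<open>Crashing by one unit\<close>

lemma accelerate_simps [simp]: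
  "network (accelerate N X) = network N" "source (accelerate N X) = source N"
  "sink (accelerate N X) = sink N" "min_len (accelerate N X) = min_len N"
  "len (accelerate N X) e = len N e - count X e" "rate (accelerate N X) = rate N"
  by (auto simp: accelerate_def)

lemma accelerate_accelerate: "accelerate (accelerate N X) Y = accelerate N (X + Y)"
  by (simp add: accelerate_def)

lemma accelerate_empty [simp]: "accelerate N {#} = N"
  by (simp add: accelerate_def)

lemma cost_accelerate [simp]: "cost (accelerate N X) = cost N"
  by (simp add: cost_def fun_eq_iff)

lemma duration_eq_max_len:
  "duration N = pre_digraph.max_len (network N) (len N) (source N) (sink N)"
  by (simp add: duration_def path_len_def [abs_def] project_paths_def pre_digraph.max_len_def)

lemma cost_sum: "cost N (\<Sum>i\<in>I. A i) = (\<Sum>i\<in>I. cost N (A i))"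
  unfolding cost_def by (subst sum.swap) (simp add: count_sum sum_distrib_left)

lemma cost_mono:
  assumes "\<And>e. e \<in> arcs (network N) \<Longrightarrow> 0 \<le> rate N e" "X \<subseteq># Y"
  shows "cost N X \<le> cost N Y"
  unfolding cost_def using assms
  by (intro sum_mono mult_left_mono) (auto simp: mset_subset_eq_count)

lemma is_plan_mono: "is_plan N Y \<Longrightarrow> X \<subseteq># Y \<Longrightarrow> is_plan N X"
  unfolding is_plan_def by (meson mset_subset_eq_count order_trans set_mset_mono)

text \<open>Shortening a whole cut may overshoot, while a crashing plan must hit the duration
  exactly. When the elements of \<open>W\<close> are added one at a time, the duration drops by at
  most one each time, so it cannot skip \<open>duration N - 1\<close>.\<close>

lemma crash_by_one_submset:
  assumes "fin_dag (network N)" "pre_digraph.awalk (network N) (source N) q (sink N)"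
    and "duration (accelerate N W) < duration N"
  obtains Z where "Z \<subseteq># W" "duration (accelerate N Z) + 1 = duration N"
proof -
  interpret fin_dag "network N" by fact
  have "\<exists>Z. Z \<subseteq># W \<and> duration (accelerate N Z) + 1 = duration N"
    using assms(3)
  proof (induction W)
    case (add a W)
    show ?case
    proof (cases "duration (accelerate N W) < duration N")
      case True
      then obtain Z where "Z \<subseteq># W" "duration (accelerate N Z) + 1 = duration N"
        using add.IH by blast
      moreover have "W \<subseteq># add_mset a W"
        by simp
      ultimately show ?thesis
        by (meson subset_mset.order_trans)
    next
      case False
      have "duration (accelerate N W) \<le> duration (accelerate N (add_mset a W)) + 1"
        using max_len_decrease_unit[OF assms(2), of a "len (accelerate N W)"
            "len (accelerate N (add_mset a W))"]
        by (simp add: duration_eq_max_len)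
      then show ?thesis
        using False add.prems by (intro exI[of _ "add_mset a W"]) auto
    qed
  qed simp
  then show ?thesis using that by auto
qed

text \<open>The cheapest of the \<open>m\<close> level cuts costs at most the average. It shortens
  every critical path, and a submultiset of it, no dearer because rates are nonnegative, shortens
  the project by exactly one.\<close>

lemma cheap_one_crashing:
  fixes N :: "('v, 'e) job_network"
  assumes "fin_dag (network N)" "pre_digraph.awalk (network N) (source N) q (sink N)"
    and rate: "\<And>e. e \<in> arcs (network N) \<Longrightarrow> 0 \<le> rate N e"
    and "is_plan N X" "duration (accelerate N X) + m \<le> duration N" "m \<ge> 1"
  obtains Z where "crashing 1 N Z" "real m * cost N Z \<le> cost N X"
proof -
  interpret fin_dag "network N" by fact
  let ?E = "arcs (network N)"
  have shorter: "max_len (\<lambda>e. len N e - count X e) (source N) (sink N) + m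
      \<le> max_len (len N) (source N) (sink N)"
    using assms(5) by (simp add: duration_eq_max_len accelerate_def)
  obtain C :: "nat \<Rightarrow> 'e set" where C: "\<And>j. C j \<subseteq> ?E"
    and hit: "\<And>j p. \<lbrakk>j \<in> {1..m}; awalk (source N) p (sink N);
      sum_list (map (len N) p) = max_len (len N) (source N) (sink N)\<rbrakk> \<Longrightarrow> set p \<inter> C j \<noteq> {}"
    and mult: "\<And>e. card {j \<in> {1..m}. e \<in> C j} \<le> count X e"
    by (rule level_cuts[OF assms(2) shorter]) (rule that)
  have fin: "finite (C j)" for j
    using C by (rule finite_subset) simp
  have cost_C: "cost N (mset_set (C j)) = (\<Sum>e\<in>?E. if e \<in> C j then rate N e else 0)" for j
    unfolding cost_def by (intro sum.cong) (auto simp: count_mset_set' fin)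
  \<comment> \<open>Double counting: an edge is paid for once per cut containing it, at most
    \<open>count X e\<close> times.\<close>
  have "(\<Sum>j\<in>{1..m}. cost N (mset_set (C j)))
      = (\<Sum>e\<in>?E. rate N e * real (card {j \<in> {1..m}. e \<in> C j}))"
    unfolding cost_C by (subst sum.swap) (simp add: sum.If_cases Int_def mult.commute)
  also have "\<dots> \<le> cost N X"
    unfolding cost_def using rate mult by (intro sum_mono mult_left_mono) auto
  finally have total: "(\<Sum>j\<in>{1..m}. cost N (mset_set (C j))) \<le> cost N X" .
  have "\<exists>j\<in>{1..m}. real m * cost N (mset_set (C j)) \<le> cost N X"
  proof (rule ccontr)
    assume "\<not> ?thesis"
    then have "\<And>j. j \<in> {1..m} \<Longrightarrow> cost N X / real m < cost N (mset_set (C j))"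
      using assms(6) by (simp add: not_le pos_divide_less_eq mult.commute)
    then have "(\<Sum>j\<in>{1..m}. cost N X / real m) < (\<Sum>j\<in>{1..m}. cost N (mset_set (C j)))"
      using assms(6) by (intro sum_strict_mono) auto
    then show False
      using total assms(6) by simp
  qed
  then obtain j where j: "j \<in> {1..m}" and cheap: "real m * cost N (mset_set (C j)) \<le> cost N X"
    by blast
  let ?W = "mset_set (C j)"
  \<comment> \<open>The index \<open>j\<close> itself is counted in the bound
    \<open>mult\<close>.\<close>
  have in_X: "count X e \<ge> 1" if "e \<in> C j" for e
  proof -
    have "card {i \<in> {1..m}. e \<in> C i} > 0"
      using that j by (auto simp: card_gt_0_iff)
    then show ?thesis
      using mult[of e] by linarith
  qed
  then have "?W \<subseteq># X"
    by (auto simp: subseteq_mset_def count_mset_set' fin)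
  then have plan: "is_plan N ?W"
    using assms(4) is_plan_mono by blast
  have "duration (accelerate N ?W) < duration N"
  proof -
    let ?g = "\<lambda>e. len N e - count ?W e"
    obtain p where p: "awalk (source N) p (sink N)"
      "sum_list (map ?g p) = max_len ?g (source N) (sink N)"
      using max_len_attained[OF assms(2)] .
    have le: "sum_list (map ?g p) \<le> sum_list (map (len N) p)"
      by (intro sum_list_mono) auto
    have "sum_list (map ?g p) < max_len (len N) (source N) (sink N)"
    \<comment> \<open>A walk \<open>p\<close> that was critical before contains a cut edge and gets
      strictly shorter; any other was already below the maximum.\<close>
    proof (cases "sum_list (map (len N) p) = max_len (len N) (source N) (sink N)")
      case True
      then obtain e where e: "e \<in> set p" "e \<in> C j"
        using hit[OF j p(1)] by auto
      \<comment> \<open>Truncated subtraction shortens \<open>e\<close> strictly only if its length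
        is positive; this holds because the plan \<open>X\<close> uses \<open>e\<close>.\<close>
      have "count X e \<le> len N e"
        using e(2) C assms(4) by (force simp: is_plan_def)
      with in_X[OF e(2)] have "1 \<le> len N e"
        by (rule order_trans)
      then have "?g e < len N e"
        using e(2) fin by simp
      then have "sum_list (map ?g p) < sum_list (map (len N) p)"
        unfolding sum_list_distinct_conv_sum_set[OF awalk_distinct[OF p(1)]]
        using e(1) by (intro sum_strict_mono_ex1) auto
      then show ?thesis using True by simp
    next
      case False
      then show ?thesis
        using le max_len_ge[OF p(1), of "len N"] by simp
    qed
    then show ?thesis
      using p(2) by (simp add: duration_eq_max_len accelerate_def)
  qed
  then obtain Z where Z: "Z \<subseteq># ?W" "duration (accelerate N Z) + 1 = duration N"
    using crash_by_one_submset[OF assms(1,2)] by metis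
  have "real m * cost N Z \<le> cost N X"
    using mult_left_mono[OF cost_mono[of N, OF rate Z(1)], of "real m"] cheap by simp
  moreover have "crashing 1 N Z"
    using Z is_plan_mono[OF plan] by (auto simp: crashing_def)
  ultimately show ?thesis using that by blast
qed

lemma (in project) fin_dag_network: "fin_dag (network N)"
  by unfold_locales (rule acyclic)

section \<open>The greedy algorithm\<close>

lemma duration_greedy:
  assumes "greedy_run N k A" "i \<le> k"
  shows "int (duration (accelerate N (\<Sum>j\<in>{1..i}. A j))) = int (duration N) - int i"
  using assms(2)
proof (induction i)
  case (Suc i)
  have "crashing 1 (accelerate N (\<Sum>j\<in>{1..<Suc i}. A j)) (A (Suc i))"
    using bspec[OF assms(1)[unfolded greedy_run_def], of "Suc i"] Suc.prems
    by (simp add: min_cost_crashing_def is_arg_min_def)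
  then show ?case
    using Suc by (simp add: crashing_def accelerate_accelerate atLeastLessThanSuc_atLeastAtMost)
qed simp

theorem theorem2p1:
  fixes N :: "('v, 'e) job_network" and k :: nat
    and A :: "nat \<Rightarrow> 'e multiset" and G OPT :: "'e multiset"
  assumes "project N"
    and "k \<ge> 1"
    and "int k \<le> k_max N"
    and "greedy_run N k A"
    and "G = (\<Sum>i \<in> {1..k}. A i)"
    and "min_cost_crashing k N OPT"
  shows "cost N G \<le> (\<Sum>i \<in> {1..k}. 1 / real i) * cost N OPT"
proof -
  interpret project N by fact
  interpret fin_dag "network N" by (rule fin_dag_network)
  have OPT: "is_plan N OPT" "int (duration (accelerate N OPT)) = int (duration N) - int k"
    using assms(6) by (auto simp: min_cost_crashing_def is_arg_min_def crashing_def)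
  \<comment> \<open>Without a path both durations would be the same unspecified \<open>Max {}\<close>.\<close>
  have "project_paths N \<noteq> {}"
  proof
    assume "project_paths N = {}"
    then have "duration (accelerate N OPT) = duration N"
      by (simp add: duration_def project_paths_def)
    then show False using OPT(2) assms(2) by simp
  qed
  then obtain q where q: "awalk (source N) q (sink N)"
    by (auto simp: project_paths_def apath_def)
  have step: "cost N (A i) \<le> 1 / real (k + 1 - i) * cost N OPT" if i: "i \<in> {1..k}" for i
  proof -
    define B where "B = (\<Sum>j\<in>{1..<i}. A j)"
    define M where "M = accelerate N B"
    have M_simps: "network M = network N" "source M = source N" "sink M = sink N"
      "min_len M = min_len N" "rate M = rate N" "cost M = cost N"
      "len M = (\<lambda>e. len N e - count B e)"
      by (auto simp: M_def)
    have greedy: "is_arg_min (cost N) (crashing 1 M) (A i)"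
      using assms(4) i by (simp add: greedy_run_def min_cost_crashing_def M_def B_def)
    have "{1..<i} = {1..i - 1}"
      using i by auto
    moreover have "i - 1 \<le> k"
      using i by auto
    ultimately have dM: "int (duration M) = int (duration N) - (int i - 1)"
      using duration_greedy[OF assms(4), of "i - 1"] i by (simp add: M_def B_def of_nat_diff)
    \<comment> \<open>Multiset difference truncates where \<open>B\<close> exceeds
      \<open>OPT\<close>; elsewhere both the multiplicity and the allowance drop by
      \<open>count B e\<close>.\<close>
    have plan: "is_plan M (OPT - B)"
      using OPT(1) unfolding is_plan_def M_simps
      by (force dest: in_diffD intro: diff_le_mono simp: diff_commute[of _ "count B _"])
    \<comment> \<open>\<open>B + (OPT - B)\<close> contains \<open>OPT\<close>, so each edge is at
      most as long as under \<open>OPT\<close> alone.\<close>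
    have "duration (accelerate M (OPT - B)) \<le> duration (accelerate N OPT)"
      unfolding duration_eq_max_len M_def accelerate_accelerate accelerate_simps
      by (rule max_len_mono[OF q]) simp
    then have less: "duration (accelerate M (OPT - B)) + (k + 1 - i) \<le> duration M"
      using OPT(2) dM i by auto
    have pos: "k + 1 - i \<ge> 1"
      using i by auto
    obtain Z where Z: "crashing 1 M Z" "real (k + 1 - i) * cost N Z \<le> cost N (OPT - B)"
      by (rule cheap_one_crashing[OF _ _ _ plan less pos, unfolded M_simps,
            OF fin_dag_axioms q rate_nonneg]) (assumption, rule that)
    have "cost N (A i) \<le> cost N Z"
      using greedy Z(1) by (force simp: is_arg_min_def not_less)
    then have "real (k + 1 - i) * cost N (A i) \<le> real (k + 1 - i) * cost N Z"
      by (intro mult_left_mono) auto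
    also have "\<dots> \<le> cost N OPT"
      using Z(2) cost_mono[of N "OPT - B" OPT] rate_nonneg by simp
    finally show ?thesis
      using i by (simp add: field_simps)
  qed
  have "cost N G = (\<Sum>i\<in>{1..k}. cost N (A i))"
    by (simp add: assms(5) cost_sum)
  also have "\<dots> \<le> (\<Sum>i\<in>{1..k}. 1 / real (k + 1 - i) * cost N OPT)"
    by (intro sum_mono step)
  also have "\<dots> = (\<Sum>i\<in>{1..k}. 1 / real (k + 1 - i)) * cost N OPT"
    by (simp add: sum_distrib_right)
  \<comment> \<open>The denominators run from \<open>k\<close> down to 1; reversing the index gives
    the harmonic sum.\<close>
  also have "(\<Sum>i\<in>{1..k}. 1 / real (k + 1 - i)) = (\<Sum>i\<in>{1..k}. 1 / real i)"
    by (subst sum.atLeastAtMost_rev) (intro sum.cong, auto)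
  finally show ?thesis .
qed

end
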